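(* Let $N,D\ge 1$, let $\boldsymbol{X}=\{\boldsymbol{x}_1,\dots,\boldsymbol{x}_N\}\subset\mathbb{R}^D$ be any dataset, let $\lambda\ge 0$ and $\sigma>0$ be fixed, and let $\mathcal{A}$ be the fixed class of admissible encoder-decoder pairs $(\boldsymbol{\psi},\boldsymbol{\rho})$ ($\boldsymbol{\rho}$ the encoder, $\boldsymbol{\psi}$ the decoder). Let $L_d(\boldsymbol{\psi},\boldsymbol{\rho},\boldsymbol{b})$, for $(\boldsymbol{\psi},\boldsymbol{\rho})\in\mathcal{A}$ and $\boldsymbol{b}\in\{0,1\}^N$, be the deterministic robust autoencoder loss, and let $L_{p_1}(\boldsymbol{\psi},\boldsymbol{\rho},\boldsymbol{\mu})$, for $(\boldsymbol{\psi},\boldsymbol{\rho})\in\mathcal{A}$ and $\boldsymbol{\mu}\in[-M,M]^N$, be the probabilistic loss, both as defined in the context. Assume that $L_d$ has a unique minimizer $(\boldsymbol{\psi}_d,\boldsymbol{\rho}_d,\boldsymbol{b}_d)$ over $\mathcal{A}\times\{0,1\}^N$, and that there is some $\varepsilon_0>0$ such that $$L_d(\boldsymbol{\psi},\boldsymbol{\rho},\boldsymbol{b})\ \ge\ L_d(\boldsymbol{\psi}_d,\boldsymbol{\rho}_d,\boldsymbol{b}_d)+\varepsilon_0\qquad\text{for all }(\boldsymbol{\psi},\boldsymbol{\rho},\boldsymbol{b})\in\mathcal{A}\times\{0,1\}^N\text{ with }(\boldsymbol{\psi},\boldsymbol{\rho},\boldsymbol{b})\neq(\boldsymbol{\psi}_d,\boldsymbol{\rho}_d,\boldsymbol{b}_d).$$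 Then for every sufficiently large $M>0$ the following holds: if $(\boldsymbol{\psi}_p,\boldsymbol{\rho}_p,\boldsymbol{\mu}_p)$ is a minimizer of $L_{p_1}$ over $\mathcal{A}\times[-M,M]^N$, then $(\boldsymbol{\psi}_p,\boldsymbol{\rho}_p)=(\boldsymbol{\psi}_d,\boldsymbol{\rho}_d)$, and for every $i=1,\dots,N$, $b_d[i]=1$ if $\mu_p[i]>0$ and $b_d[i]=0$ otherwise.
   Context: For a vector $\boldsymbol{v}$, $v[i]$ denotes its $i$-th entry, and $\|\boldsymbol{v}\|_0$ is the number of its nonzero entries. Encoder-decoder pairs: an encoder is a map $\boldsymbol{\rho}:\mathbb{R}^D\to\mathbb{R}^k$ and a decoder is a map $\boldsymbol{\psi}:\mathbb{R}^k\to\mathbb{R}^D$, where $k$ is the latent dimension. The class $\mathcal{A}$ of admissible pairs is fixed and is the same for both minimization problems (the motivating case is pairs of multilayer neural networks of a fixed architecture). For $(\boldsymbol{\psi},\boldsymbol{\rho})\in\mathcal{A}$, the reconstruction of $\boldsymbol{x}_i$ is $\widehat{\boldsymbol{x}}_i=\boldsymbol{\psi}(\boldsymbol{\rho}(\boldsymbol{x}_i))$. Deterministic loss (robust autoencoder): for $\boldsymbol{b}\in\{0,1\}^N$, $$L_d(\boldsymbol{\psi},\boldsymbol{\rho},\boldsymbol{b})=\sum_{i=1}^N b[i]\,\|\boldsymbol{x}_i-\widehat{\boldsymbol{x}}_i\|_2^2-\lambda\|\boldsymbol{b}\|_0 .$$ Stochastic gates: for $\boldsymbol{\mu}\in\mathbb{R}^N$,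 the random vector $\boldsymbol{z}\in[0,1]^N$ is given by $$z[i]=\max\bigl(0,\min(1,\mu[i]+\epsilon[i])\bigr),\qquad \epsilon[i]\sim\mathcal{N}(0,\sigma^2),$$ with $\sigma>0$ fixed. Probabilistic loss (with $\ell_1$ regularization): $$L_{p_1}(\boldsymbol{\psi},\boldsymbol{\rho},\boldsymbol{\mu})=\mathbb{E}\Bigl(\sum_{i=1}^N z[i]\,\|\boldsymbol{x}_i-\widehat{\boldsymbol{x}}_i\|_2^2-\lambda\|\boldsymbol{z}\|_1\Bigr),$$ where the expectation is over $\boldsymbol{z}$ and $\|\boldsymbol{z}\|_1=\sum_i z[i]$. The parameter $\boldsymbol{\mu}$ is constrained by $-M\le\mu[i]\le M$ for all $i$, so the minimization of $L_{p_1}$ is over $\boldsymbol{\mu}\in[-M,M]^N$. "Sufficiently large $M$" means that there is a threshold $M_0$, which may depend on the data $\boldsymbol{X}$, $\mathcal{A}$, $\lambda$, $\sigma$ and $\varepsilon_0$, such that the assertion holds for all $M\ge M_0$. *)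

theory Defs
  imports "HOL-Probability.Probability"
begin

text \<open>
  Encoders map \<open>real^'d\<close> to \<open>real^'k\<close> and decoders map back; the data set is a family
  \<open>x :: 'n \<Rightarrow> real^'d\<close>, so that \<open>N = CARD('n)\<close>, \<open>D = CARD('d)\<close>, \<open>k = CARD('k)\<close>.
\<close>

type_synonym ('d, 'k) encoder = "real^'d \<Rightarrow> real^'k"
type_synonym ('d, 'k) decoder = "real^'k \<Rightarrow> real^'d"

definition l0_norm :: "real^'n::finite \<Rightarrow> nat" where
  "l0_norm v = card {i. v $ i \<noteq> 0}"

definition l1_norm :: "real^'n::finite \<Rightarrow> real" where
  "l1_norm v = (\<Sum>i\<in>UNIV. \<bar>v $ i\<bar>)"

definition sq_error :: "('n \<Rightarrow> real^'d) \<Rightarrow> ('d::finite, 'k::finite) decoder \<Rightarrow> ('d, 'k) encoder \<Rightarrow> 'n \<Rightarrow> real"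
  where "sq_error x \<psi> \<rho> i = (norm (x i - \<psi> (\<rho> (x i))))\<^sup>2"

definition det_loss ::
    "real \<Rightarrow> ('n::finite \<Rightarrow> real^'d) \<Rightarrow> ('d::finite, 'k::finite) decoder \<Rightarrow> ('d, 'k) encoder \<Rightarrow> real^'n \<Rightarrow> real"
  where "det_loss lam x \<psi> \<rho> b = (\<Sum>i\<in>UNIV. b $ i * sq_error x \<psi> \<rho> i) - lam * real (l0_norm b)"

definition binary_vectors :: "(real^'n::finite) set" where
  "binary_vectors = {b. \<forall>i. b $ i \<in> {0, 1}}"

definition box_vectors :: "real \<Rightarrow> (real^'n::finite) set" where
  "box_vectors M = {\<mu>. \<forall>i. \<mu> $ i \<in> {-M..M}}"

text \<open>
  Only the marginal laws of the noise are prescribed: no independence between different indices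
  is assumed.  \<^const>\<open>normal_density\<close> takes the standard deviation as its second argument.
\<close>

definition gaussian_noise :: "'w measure \<Rightarrow> real \<Rightarrow> ('n::finite \<Rightarrow> 'w \<Rightarrow> real) \<Rightarrow> bool" where
  "gaussian_noise P \<sigma> \<epsilon> \<longleftrightarrow>
     prob_space P \<and> (\<forall>i. distributed P lborel (\<epsilon> i) (normal_density 0 \<sigma>))"

definition gates :: "('n::finite \<Rightarrow> 'w \<Rightarrow> real) \<Rightarrow> real^'n \<Rightarrow> 'w \<Rightarrow> real^'n" where
  "gates \<epsilon> \<mu> \<omega> = (\<chi> i. max 0 (min 1 (\<mu> $ i + \<epsilon> i \<omega>)))"

definition prob_loss ::
    "'w measure \<Rightarrow> ('n::finite \<Rightarrow> 'w \<Rightarrow> real) \<Rightarrow> real \<Rightarrow> ('n \<Rightarrow> real^'d) \<Rightarrow>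
     ('d::finite, 'k::finite) decoder \<Rightarrow> ('d, 'k) encoder \<Rightarrow> real^'n \<Rightarrow> real"
  where "prob_loss P \<epsilon> lam x \<psi> \<rho> \<mu> =
    (\<integral>\<omega>. (\<Sum>i\<in>UNIV. gates \<epsilon> \<mu> \<omega> $ i * sq_error x \<psi> \<rho> i) - lam * l1_norm (gates \<epsilon> \<mu> \<omega>) \<partial>P)"

definition det_minimizer ::
    "(('d::finite, 'k::finite) decoder \<times> ('d, 'k) encoder) set \<Rightarrow> real \<Rightarrow> ('n::finite \<Rightarrow> real^'d) \<Rightarrow>
     ('d, 'k) decoder \<Rightarrow> ('d, 'k) encoder \<Rightarrow> real^'n \<Rightarrow> bool"
  where "det_minimizer \<A> lam x \<psi> \<rho> b \<longleftrightarrow>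
    is_arg_min (\<lambda>(\<psi>, \<rho>, b). det_loss lam x \<psi> \<rho> b)
      (\<lambda>(\<psi>, \<rho>, b). (\<psi>, \<rho>) \<in> \<A> \<and> b \<in> binary_vectors) (\<psi>, \<rho>, b)"

definition prob_minimizer ::
    "'w measure \<Rightarrow> ('n::finite \<Rightarrow> 'w \<Rightarrow> real) \<Rightarrow>
     (('d::finite, 'k::finite) decoder \<times> ('d, 'k) encoder) set \<Rightarrow> real \<Rightarrow> ('n \<Rightarrow> real^'d) \<Rightarrow> real \<Rightarrow>
     ('d, 'k) decoder \<Rightarrow> ('d, 'k) encoder \<Rightarrow> real^'n \<Rightarrow> bool"
  where "prob_minimizer P \<epsilon> \<A> lam x M \<psi> \<rho> \<mu> \<longleftrightarrow>
    is_arg_min (\<lambda>(\<psi>, \<rho>, \<mu>). prob_loss P \<epsilon> lam x \<psi> \<rho> \<mu>)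
      (\<lambda>(\<psi>, \<rho>, \<mu>). (\<psi>, \<rho>) \<in> \<A> \<and> \<mu> \<in> box_vectors M) (\<psi>, \<rho>, \<mu>)"

end

theory Submission
  imports Defs
begin

text \<open>
  Writing \<open>w\<^sub>i = sq_error x \<psi> \<rho> i - lam\<close> and \<open>g m = E[max 0 (min 1 (m + \<epsilon>))]\<close>, both losses become linear in
  the \<open>w\<^sub>i\<close>: the deterministic one is \<open>\<Sum>i. b\<^sub>i w\<^sub>i\<close> and the probabilistic one is \<open>\<Sum>i. g \<mu>\<^sub>i * w\<^sub>i\<close>.
  As \<open>g\<close> is strictly increasing, for the fixed pair \<open>(\<psi>\<^sub>d, \<rho>\<^sub>d)\<close> the only optimal \<open>\<mu>\<close> pushes every \<open>\<mu>\<^sub>i\<close> to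
  \<open>M\<close> or \<open>-M\<close> according to the sign of \<open>w\<^sub>i\<close>, which is nonzero because flipping \<open>b\<^sub>i\<close> costs at least \<open>\<epsilon>\<^sub>0\<close>.
  The resulting value is \<open>g M * L\<^sub>d + g (-M) * G\<close> with \<open>L\<^sub>d\<close> the minimum of the deterministic loss and
  \<open>G\<close> a constant, whereas any other pair has loss at least \<open>g M * (L\<^sub>d + \<epsilon>\<^sub>0)\<close>; since \<open>g (-M)\<close> tends
  to 0, this is larger once \<open>M\<close> is large.
\<close>

text \<open>Integrating against the normal law itself keeps \<open>P\<close> and
  \<open>\<epsilon>\<close> out, so that the threshold for \<open>M\<close> can be chosen before any
  noise model is given.\<close>

definition mean_gate :: "real \<Rightarrow> real \<Rightarrow> real" where
  "mean_gate \<sigma> m = (\<integral>t. max 0 (min 1 (m + t)) \<partial>density lborel (normal_density 0 \<sigma>))"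

lemma integrable_clip:
  fixes f :: "'a \<Rightarrow> real"
  assumes "prob_space M" and "f \<in> borel_measurable M"
  shows "integrable M (\<lambda>t. max 0 (min 1 (f t)))"
proof -
  interpret prob_space M by fact
  show ?thesis
    using assms(2) by (intro integrable_const_bound[where B = 1]) auto
qed

lemma integrable_clip_normal:
  assumes "\<sigma> > 0"
  shows "integrable (density lborel (normal_density 0 \<sigma>)) (\<lambda>t. max 0 (min 1 (m + t)))"
  using assms by (intro integrable_clip prob_space_normal_density) auto

lemma mean_gate_nonneg: "mean_gate \<sigma> m \<ge> 0"
  unfolding mean_gate_def by (intro integral_nonneg_AE) auto

lemma strict_mono_mean_gate:
  assumes "\<sigma> > 0"
  shows "strict_mono (mean_gate \<sigma>)"
proof (rule strict_monoI)
  fix m n :: real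
  assume "m < n"
  let ?Q = "density lborel (normal_density 0 \<sigma>)"
  let ?h = "\<lambda>t. max 0 (min 1 (n + t)) - max 0 (min 1 (m + t))"
  have int: "integrable ?Q ?h"
    using assms by (intro Bochner_Integration.integrable_diff integrable_clip_normal)
  have nonneg: "?h t \<ge> 0" for t using \<open>m < n\<close> by auto
  have eq: "integral\<^sup>L ?Q ?h = mean_gate \<sigma> n - mean_gate \<sigma> m"
    unfolding mean_gate_def
    using assms by (intro Bochner_Integration.integral_diff integrable_clip_normal)
  have "integral\<^sup>L ?Q ?h \<noteq> 0"
  proof
    assume "integral\<^sup>L ?Q ?h = 0"
    then have "AE t in ?Q. ?h t = 0"
      using integral_nonneg_eq_0_iff_AE[OF int] nonneg by auto
    then have "AE t in lborel. ?h t = 0"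
      using assms by (subst (asm) AE_density) (auto simp: normal_density_pos)
    \<comment> \<open>On this interval \<open>n + t\<close> lies strictly between 0 and 1, so the
      clip at \<open>n\<close> is inactive and replacing \<open>n\<close> by the smaller
      \<open>m\<close> strictly lowers the value. The interval has length 1, so it cannot be a null
      set.\<close>
    then have "AE t in lborel. t \<notin> {-n<..<1-n}"
      using \<open>m < n\<close> by (auto elim!: eventually_mono)
    then have "emeasure lborel {-n<..<1-n} = 0"
      by (subst (asm) AE_iff_measurable[of "{-n<..<1-n}"]) auto
    then show False by simp
  qed
  then show "mean_gate \<sigma> m < mean_gate \<sigma> n"
    using eq Bochner_Integration.integral_nonneg[of ?Q ?h] nonneg by fastforce
qed

text \<open>Dominated convergence with bound 1: for fixed \<open>t\<close> the integrand vanishes as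
  soon as \<open>M \<ge> t\<close>.\<close>

lemma mean_gate_tendsto_0:
  assumes "\<sigma> > 0"
  shows "((\<lambda>M. mean_gate \<sigma> (-M)) \<longlongrightarrow> 0) at_top"
proof -
  let ?Q = "density lborel (normal_density 0 \<sigma>)"
  interpret prob_space ?Q using assms by (rule prob_space_normal_density)
  have "((\<lambda>M. \<integral>t. max 0 (min 1 (-M + t)) \<partial>?Q) \<longlongrightarrow> (\<integral>t. 0 \<partial>?Q)) at_top"
  proof (rule integral_dominated_convergence_at_top[where w = "\<lambda>_. 1"])
    show "\<forall>\<^sub>F M in at_top. AE t in ?Q. norm (max 0 (min 1 (-M + t))) \<le> 1"
      by (intro always_eventually allI AE_I2) auto
    show "AE t in ?Q. ((\<lambda>M. max 0 (min 1 (-M + t))) \<longlongrightarrow> 0) at_top"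
    proof (rule AE_I2)
      fix t :: real
      have "\<forall>\<^sub>F M in at_top. max 0 (min 1 (-M + t)) = 0"
        using eventually_ge_at_top[of t] by eventually_elim auto
      then show "((\<lambda>M. max 0 (min 1 (-M + t))) \<longlongrightarrow> 0) at_top"
        by (rule tendsto_eventually)
    qed
  qed auto
  then show ?thesis by (simp add: mean_gate_def)
qed

lemma expectation_gate:
  assumes "gaussian_noise P \<sigma> \<epsilon>"
  shows "(\<integral>\<omega>. gates \<epsilon> \<mu> \<omega> $ i \<partial>P) = mean_gate \<sigma> (\<mu> $ i)"
proof -
  have "distributed P lborel (\<epsilon> i) (normal_density 0 \<sigma>)"
    using assms by (simp add: gaussian_noise_def)
  then have [measurable]: "\<epsilon> i \<in> borel_measurable P"
    and distr: "distr P lborel (\<epsilon> i) = density lborel (normal_density 0 \<sigma>)"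
    by (auto simp: distributed_def)
  have "(\<integral>t. max 0 (min 1 (\<mu> $ i + t)) \<partial>distr P lborel (\<epsilon> i)) =
        (\<integral>\<omega>. max 0 (min 1 (\<mu> $ i + \<epsilon> i \<omega>)) \<partial>P)"
    by (intro integral_distr) auto
  then show ?thesis by (simp add: gates_def mean_gate_def distr)
qed

lemma integrable_gate:
  assumes "gaussian_noise P \<sigma> \<epsilon>"
  shows "integrable P (\<lambda>\<omega>. gates \<epsilon> \<mu> \<omega> $ i)"
proof -
  have "prob_space P" and "\<epsilon> i \<in> borel_measurable P"
    using assms by (auto simp: gaussian_noise_def distributed_def)
  then show ?thesis
    by (auto simp: gates_def intro!: integrable_clip)
qed

text \<open>Gates are nonnegative, so their l1 norm is a plain sum and the loss is linear in them;
  expectation then acts on each gate through its marginal law.\<close>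

lemma prob_loss_eq:
  assumes "gaussian_noise P \<sigma> \<epsilon>"
  shows "prob_loss P \<epsilon> lam x \<psi> \<rho> \<mu> =
    (\<Sum>i\<in>UNIV. mean_gate \<sigma> (\<mu> $ i) * (sq_error x \<psi> \<rho> i - lam))"
proof -
  have "\<bar>gates \<epsilon> \<mu> \<omega> $ i\<bar> = gates \<epsilon> \<mu> \<omega> $ i" for \<omega> i
    by (simp add: gates_def)
  then have "prob_loss P \<epsilon> lam x \<psi> \<rho> \<mu> =
      (\<integral>\<omega>. (\<Sum>i\<in>UNIV. gates \<epsilon> \<mu> \<omega> $ i * (sq_error x \<psi> \<rho> i - lam)) \<partial>P)"
    by (simp add: prob_loss_def l1_norm_def sum_distrib_left sum_subtractf algebra_simps)
  also have "\<dots> = (\<Sum>i\<in>UNIV. mean_gate \<sigma> (\<mu> $ i) * (sq_error x \<psi> \<rho> i - lam))"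
    using integrable_gate[OF assms] by (simp add: expectation_gate[OF assms])
  finally show ?thesis .
qed

text \<open>For a 0/1 vector the number of nonzero entries is the sum of the entries, so the penalty
  merges into the weights.\<close>

lemma det_loss_eq:
  assumes "b \<in> binary_vectors"
  shows "det_loss lam x \<psi> \<rho> b = (\<Sum>i\<in>UNIV. b $ i * (sq_error x \<psi> \<rho> i - lam))"
proof -
  have "b $ i = (if b $ i \<noteq> 0 then 1 else 0)" for i
    using assms by (auto simp: binary_vectors_def)
  then have "(\<Sum>i\<in>UNIV. b $ i) = (\<Sum>i\<in>UNIV. if b $ i \<noteq> 0 then 1 else 0)"
    by (intro sum.cong) auto
  also have "\<dots> = real (l0_norm b)"
    by (simp add: l0_norm_def sum.If_cases)
  finally show ?thesis
    by (simp add: det_loss_def sum_subtractf algebra_simps flip: sum_distrib_left)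
qed

lemma det_minimizerD:
  assumes "det_minimizer \<A> lam x \<psi> \<rho> b"
  shows "(\<psi>, \<rho>) \<in> \<A>" and "b \<in> binary_vectors"
  using assms by (auto simp: det_minimizer_def is_arg_min_def)

lemma prob_minimizerD:
  assumes "prob_minimizer P \<epsilon> \<A> lam x M \<psi> \<rho> \<mu>"
  shows "(\<psi>, \<rho>) \<in> \<A>" and "\<mu> \<in> box_vectors M"
    and "(\<psi>', \<rho>') \<in> \<A> \<Longrightarrow> \<mu>' \<in> box_vectors M \<Longrightarrow>
      prob_loss P \<epsilon> lam x \<psi> \<rho> \<mu> \<le> prob_loss P \<epsilon> lam x \<psi>' \<rho>' \<mu>'"
  using assms by (auto simp: prob_minimizer_def is_arg_min_def not_less)

text \<open>Flipping entry \<open>i\<close> alone changes the loss by exactly the left-hand side;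
  the factor \<open>1 - 2 * b $ i\<close> is 1 when the entry rises from 0 and -1 when it drops from
  1.\<close>

lemma flip_gap:
  fixes b :: "real^'n::finite"
  assumes "b \<in> binary_vectors"
    and gap: "\<And>b'. b' \<in> binary_vectors \<Longrightarrow> b' \<noteq> b \<Longrightarrow>
      det_loss lam x \<psi> \<rho> b' \<ge> det_loss lam x \<psi> \<rho> b + e"
  shows "(1 - 2 * b $ i) * (sq_error x \<psi> \<rho> i - lam) \<ge> e"
proof -
  let ?w = "\<lambda>j. sq_error x \<psi> \<rho> j - lam"
  define b' :: "real^'n" where "b' = (\<chi> j. if j = i then 1 - b $ i else b $ j)"
  have bi: "b $ i = 0 \<or> b $ i = 1" and b': "b' \<in> binary_vectors"
    using assms(1) by (auto simp: b'_def binary_vectors_def)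
  have "b' $ i \<noteq> b $ i" using bi by (auto simp: b'_def)
  then have "b' \<noteq> b" by auto
  have "(\<Sum>j\<in>UNIV. b' $ j * ?w j) - (\<Sum>j\<in>UNIV. b $ j * ?w j) =
      (\<Sum>j\<in>UNIV. if j = i then (1 - 2 * b $ i) * ?w i else 0)"
    unfolding sum_subtractf[symmetric] by (intro sum.cong) (auto simp: b'_def algebra_simps)
  also have "\<dots> = (1 - 2 * b $ i) * ?w i" by simp
  finally show ?thesis
    using gap[OF b' \<open>b' \<noteq> b\<close>] by (simp add: det_loss_eq[OF assms(1)] det_loss_eq[OF b'])
qed

theorem theorem4p1:
  fixes x :: "'n::finite \<Rightarrow> real^'d::finite"
    and \<A> :: "(('d, 'k::finite) decoder \<times> ('d, 'k) encoder) set"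
    and lam \<sigma> \<epsilon>\<^sub>0 :: real
    and \<psi>\<^sub>d :: "('d, 'k) decoder" and \<rho>\<^sub>d :: "('d, 'k) encoder" and b\<^sub>d :: "real^'n"
  assumes "lam \<ge> 0" and "\<sigma> > 0"
    and "det_minimizer \<A> lam x \<psi>\<^sub>d \<rho>\<^sub>d b\<^sub>d"
    and "\<And>\<psi> \<rho> b. det_minimizer \<A> lam x \<psi> \<rho> b \<Longrightarrow> (\<psi>, \<rho>, b) = (\<psi>\<^sub>d, \<rho>\<^sub>d, b\<^sub>d)"
    and "\<epsilon>\<^sub>0 > 0"
    and "\<And>\<psi> \<rho> b. (\<psi>, \<rho>) \<in> \<A> \<Longrightarrow> b \<in> binary_vectors \<Longrightarrow> (\<psi>, \<rho>, b) \<noteq> (\<psi>\<^sub>d, \<rho>\<^sub>d, b\<^sub>d) \<Longrightarrow>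
           det_loss lam x \<psi> \<rho> b \<ge> det_loss lam x \<psi>\<^sub>d \<rho>\<^sub>d b\<^sub>d + \<epsilon>\<^sub>0"
  shows "\<exists>M\<^sub>0>0. \<forall>M\<ge>M\<^sub>0. \<forall>(P :: 'w measure) \<epsilon>. gaussian_noise P \<sigma> \<epsilon> \<longrightarrow>
           (\<forall>\<psi>\<^sub>p \<rho>\<^sub>p \<mu>\<^sub>p. prob_minimizer P \<epsilon> \<A> lam x M \<psi>\<^sub>p \<rho>\<^sub>p \<mu>\<^sub>p \<longrightarrow>
             (\<psi>\<^sub>p, \<rho>\<^sub>p) = (\<psi>\<^sub>d, \<rho>\<^sub>d) \<and>
             (\<forall>i. b\<^sub>d $ i = (if \<mu>\<^sub>p $ i > 0 then 1 else 0)))"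
proof -
  define w where "w \<psi> \<rho> i = sq_error x \<psi> \<rho> i - lam" for \<psi> :: "('d, 'k) decoder" and \<rho> i
  define g where "g = mean_gate \<sigma>"
  define Ld where "Ld = (\<Sum>i\<in>UNIV. b\<^sub>d $ i * w \<psi>\<^sub>d \<rho>\<^sub>d i)"
  \<comment> \<open>Total weight of the samples rejected by \<open>b\<^sub>d\<close>. Their gates
    never close fully in the mean, which leaves the error term \<open>g (-M) * G\<close>.\<close>
  define G where "G = (\<Sum>i\<in>UNIV. (1 - b\<^sub>d $ i) * w \<psi>\<^sub>d \<rho>\<^sub>d i)"
  note d = det_minimizerD[OF assms(3)]
  have g_nonneg: "g m \<ge> 0" for m by (simp add: g_def mean_gate_nonneg)
  have g_less: "g m < g n \<longleftrightarrow> m < n" for m n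
    using strict_mono_less[OF strict_mono_mean_gate[OF assms(2)]] by (simp add: g_def)
  have g_le: "g m \<le> g n \<longleftrightarrow> m \<le> n" for m n
    using strict_mono_less_eq[OF strict_mono_mean_gate[OF assms(2)]] by (simp add: g_def)
  have g0: "g 0 > 0" using g_nonneg[of "-1"] g_less[of "-1" 0] by simp
  have bd: "b\<^sub>d $ i = 0 \<and> w \<psi>\<^sub>d \<rho>\<^sub>d i > 0 \<or> b\<^sub>d $ i = 1 \<and> w \<psi>\<^sub>d \<rho>\<^sub>d i < 0" for i
  proof -
    have "(1 - 2 * b\<^sub>d $ i) * w \<psi>\<^sub>d \<rho>\<^sub>d i \<ge> \<epsilon>\<^sub>0"
      unfolding w_def using d(2) by (rule flip_gap) (use assms(6) d(1) in auto)
    moreover have "b\<^sub>d $ i = 0 \<or> b\<^sub>d $ i = 1"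
      using d(2) by (auto simp: binary_vectors_def)
    ultimately show ?thesis using assms(5) by auto
  qed
  \<comment> \<open>The sum is the least deterministic loss of this pair, attained by selecting the
    negative weights. As the pair differs from the optimal one, the gap applies whatever this
    selection is.\<close>
  have other: "(\<Sum>i\<in>UNIV. min 0 (w \<psi> \<rho> i)) \<ge> Ld + \<epsilon>\<^sub>0"
    if "(\<psi>, \<rho>) \<in> \<A>" and "(\<psi>, \<rho>) \<noteq> (\<psi>\<^sub>d, \<rho>\<^sub>d)" for \<psi> \<rho>
  proof -
    define b :: "real^'n" where "b = (\<chi> i. if w \<psi> \<rho> i < 0 then 1 else 0)"
    have b: "b \<in> binary_vectors" by (auto simp: b_def binary_vectors_def)
    have "det_loss lam x \<psi> \<rho> b = (\<Sum>i\<in>UNIV. min 0 (w \<psi> \<rho> i))"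
      unfolding det_loss_eq[OF b] w_def[symmetric] by (intro sum.cong) (auto simp: b_def)
    moreover have "det_loss lam x \<psi> \<rho> b \<ge> det_loss lam x \<psi>\<^sub>d \<rho>\<^sub>d b\<^sub>d + \<epsilon>\<^sub>0"
      using that b by (intro assms(6)) auto
    ultimately show ?thesis by (simp add: det_loss_eq[OF d(2)] Ld_def w_def)
  qed
  have "((\<lambda>M. g (-M) * G) \<longlongrightarrow> 0 * G) at_top"
    unfolding g_def by (intro tendsto_mult_right mean_gate_tendsto_0 assms(2))
  \<comment> \<open>The bound uses \<open>g 0\<close> because it is positive, independent of
    \<open>M\<close>, and at most \<open>g M\<close> for \<open>M > 0\<close>.\<close>
  then have "\<forall>\<^sub>F M in at_top. g (-M) * G < g 0 * \<epsilon>\<^sub>0"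
    by (rule order_tendstoD) (use g0 assms(5) in simp)
  then obtain M\<^sub>1 where M1: "\<And>M. M \<ge> M\<^sub>1 \<Longrightarrow> g (-M) * G < g 0 * \<epsilon>\<^sub>0"
    by (auto simp: eventually_at_top_linorder)
  show ?thesis
  \<comment> \<open>The 1 makes the threshold positive and forces \<open>M > 0\<close>, so that the
    signs of the entries \<open>M\<close> and \<open>-M\<close> reveal
    \<open>b\<^sub>d\<close>.\<close>
  proof (intro exI[of _ "max 1 M\<^sub>1"] conjI allI impI)
    fix M and P :: "'w measure" and \<epsilon> \<psi> \<rho> \<mu>
    assume "max 1 M\<^sub>1 \<le> M" and noise: "gaussian_noise P \<sigma> \<epsilon>"
      and min: "prob_minimizer P \<epsilon> \<A> lam x M \<psi> \<rho> \<mu>"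
    then have M: "M > 0" "M \<ge> M\<^sub>1" by auto
    note p = prob_minimizerD[OF min]
    have loss: "prob_loss P \<epsilon> lam x \<psi> \<rho> \<mu> = (\<Sum>i\<in>UNIV. g (\<mu> $ i) * w \<psi> \<rho> i)" for \<psi> \<rho> \<mu>
      by (simp add: prob_loss_eq[OF noise] g_def w_def)
    \<comment> \<open>The corner of the box that encodes \<open>b\<^sub>d\<close>: first a
      competitor bounding the minimum from above, later shown to equal \<open>\<mu>\<close>.\<close>
    define \<mu>\<^sub>d :: "real^'n" where "\<mu>\<^sub>d = (\<chi> i. if b\<^sub>d $ i = 1 then M else -M)"
    have "\<mu>\<^sub>d \<in> box_vectors M" using M by (auto simp: \<mu>\<^sub>d_def box_vectors_def)
    then have le: "(\<Sum>i\<in>UNIV. g (\<mu> $ i) * w \<psi> \<rho> i) \<le> (\<Sum>i\<in>UNIV. g (\<mu>\<^sub>d $ i) * w \<psi>\<^sub>d \<rho>\<^sub>d i)"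
      using p(3)[OF d(1)] by (simp add: loss)
    have \<mu>_bounds: "-M \<le> \<mu> $ i" "\<mu> $ i \<le> M" for i
      using p(2) by (auto simp: box_vectors_def)
    show pair: "(\<psi>, \<rho>) = (\<psi>\<^sub>d, \<rho>\<^sub>d)"
    proof (rule ccontr)
      assume "(\<psi>, \<rho>) \<noteq> (\<psi>\<^sub>d, \<rho>\<^sub>d)"
      have "(\<Sum>i\<in>UNIV. g (\<mu>\<^sub>d $ i) * w \<psi>\<^sub>d \<rho>\<^sub>d i) =
          (\<Sum>i\<in>UNIV. g M * (b\<^sub>d $ i * w \<psi>\<^sub>d \<rho>\<^sub>d i) + g (-M) * ((1 - b\<^sub>d $ i) * w \<psi>\<^sub>d \<rho>\<^sub>d i))"
        using bd by (intro sum.cong) (force simp: \<mu>\<^sub>d_def)+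
      also have "\<dots> = g M * Ld + g (-M) * G"
        by (simp add: Ld_def G_def sum.distrib sum_distrib_left)
      also have "\<dots> < g M * Ld + g 0 * \<epsilon>\<^sub>0" using M1[OF M(2)] by simp
      also have "\<dots> \<le> g M * Ld + g M * \<epsilon>\<^sub>0"
        using M assms(5) by (intro add_left_mono mult_right_mono) (auto simp: g_le)
      also have "\<dots> = g M * (Ld + \<epsilon>\<^sub>0)" by (simp add: distrib_left)
      also have "\<dots> \<le> g M * (\<Sum>i\<in>UNIV. min 0 (w \<psi> \<rho> i))"
        using other[OF p(1) \<open>(\<psi>, \<rho>) \<noteq> (\<psi>\<^sub>d, \<rho>\<^sub>d)\<close>] g_nonneg by (intro mult_left_mono)
      \<comment> \<open>A nonpositive weight is best multiplied by the largest factor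
        \<open>g M\<close>; a positive weight contributes at least 0.\<close>
      also have "\<dots> \<le> (\<Sum>i\<in>UNIV. g (\<mu> $ i) * w \<psi> \<rho> i)"
        unfolding sum_distrib_left
      proof (rule sum_mono)
        fix i
        show "g M * min 0 (w \<psi> \<rho> i) \<le> g (\<mu> $ i) * w \<psi> \<rho> i"
          using \<mu>_bounds[of i] g_nonneg
          by (cases "w \<psi> \<rho> i \<le> 0") (auto simp: g_le min_def intro: mult_right_mono_neg)
      qed
      finally show False using le by simp
    qed
    \<comment> \<open>With the pair settled, the loss separates over \<open>i\<close> and
      \<open>\<mu>\<^sub>d\<close> minimizes every summand, so one strict inequality already
      contradicts the minimality of \<open>\<mu>\<close>.\<close>
    have termwise: "g (\<mu>\<^sub>d $ i) * w \<psi>\<^sub>d \<rho>\<^sub>d i \<le> g (\<mu> $ i) * w \<psi>\<^sub>d \<rho>\<^sub>d i" for i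
      using bd[of i] \<mu>_bounds[of i] by (auto simp: \<mu>\<^sub>d_def g_le)
    have "\<mu> $ i = \<mu>\<^sub>d $ i" for i
    proof (rule ccontr)
      assume "\<mu> $ i \<noteq> \<mu>\<^sub>d $ i"
      then have "g (\<mu>\<^sub>d $ i) * w \<psi>\<^sub>d \<rho>\<^sub>d i < g (\<mu> $ i) * w \<psi>\<^sub>d \<rho>\<^sub>d i"
        using bd[of i] \<mu>_bounds[of i] by (auto simp: \<mu>\<^sub>d_def g_less)
      then have "(\<Sum>i\<in>UNIV. g (\<mu>\<^sub>d $ i) * w \<psi>\<^sub>d \<rho>\<^sub>d i) < (\<Sum>i\<in>UNIV. g (\<mu> $ i) * w \<psi>\<^sub>d \<rho>\<^sub>d i)"
        using termwise by (intro sum_strict_mono_ex1) auto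
      then show False using le pair by simp
    qed
    then show "b\<^sub>d $ i = (if \<mu> $ i > 0 then 1 else 0)" for i
      using bd[of i] M by (auto simp: \<mu>\<^sub>d_def)
  qed auto
qed

end
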